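(* Let $\mathcal{C}$ be a small category, and let $X\colon\mathcal{C}\to\mathbf{Set}$ and $Y\colon\int^{\mathcal{C}}X\to\mathbf{Set}$ be functors. Then $$\mathrm{dsecat}(\pi_X)\leq\mathrm{dsecat}(\pi_{\Sigma_XY}).$$ Equivalently, $\mathrm{secat}(\pi_X)\leq\mathrm{secat}(\pi_{\Sigma_XY})$.
   Context: For a functor $X\colon\mathcal{C}\to\mathbf{Set}$, the category of elements $\int^{\mathcal{C}}X$ has objects $(c,x)$ with $x\in X(c)$; a morphism $(c,x)\to(d,y)$ is a morphism $f\colon c\to d$ in $\mathcal{C}$ with $X(f)(x)=y$. The functor $\pi_X\colon\int^{\mathcal{C}}X\to\mathcal{C}$ is the projection $(c,x)\mapsto c$. Given $Y\colon\int^{\mathcal{C}}X\to\mathbf{Set}$, the flattened database $\Sigma_XY\colon\mathcal{C}\to\mathbf{Set}$ is defined by $(\Sigma_XY)(c)=\coprod_{x\in X(c)}Y(c,x)$ and, for $f\colon c\to d$, $(\Sigma_XY)(f)(x,y)=\bigl(X(f)(x),Y(\overline f_x)(y)\bigr)$, where $\overline f_x\colon(c,x)\to(d,X(f)(x))$ is the unique morphism over $f$ with source $(c,x)$ in $\int^{\mathcal{C}}X$. A cover of a category $\mathcal{B}$ is a family of (not necessarily full) subcategories such that every morphism of $\mathcal{B}$ belongs to at least one of them. For a functor $P\colon\mathcal{E}\to\mathcal{B}$, $\mathrm{secat}(P)$ (resp. $\mathrm{dsecat}(P)$) is the least integer $n\geq0$ for which $\mathcal{B}$ admits a cover $\{\mathcal{U}_0,\dots,\mathcal{U}_n\}$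 and, for every $i$, a functor $s_i\colon\mathcal{U}_i\to\mathcal{E}$ with $P s_i=\iota_i$ (resp. together with a natural transformation $P s_i\Rightarrow\iota_i$), where $\iota_i\colon\mathcal{U}_i\hookrightarrow\mathcal{B}$ is the inclusion; it is $\infty$ if no such finite cover exists. *)

theory Defs
  imports Main "HOL-Library.FuncSet" "HOL-Library.Extended_Nat"
begin

section \<open>Small categories, functors and natural transformations\<close>

text \<open>\<open>Comp C g f\<close> is the composite \<open>g\<close> after \<open>f\<close>; the values of the operations outside
  \<open>Obj C\<close>, \<open>Arr C\<close> and the composable pairs are irrelevant.\<close>

record ('o, 'a) cat =
  Obj :: "'o set"
  Arr :: "'a set"
  Dom :: "'a \<Rightarrow> 'o"
  Cod :: "'a \<Rightarrow> 'o"
  Id :: "'o \<Rightarrow> 'a"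
  Comp :: "'a \<Rightarrow> 'a \<Rightarrow> 'a"

definition Hom :: "('o, 'a) cat \<Rightarrow> 'o \<Rightarrow> 'o \<Rightarrow> 'a set" where
  "Hom C c d = {f \<in> Arr C. Dom C f = c \<and> Cod C f = d}"

locale category =
  fixes C :: "('o, 'a) cat"
  assumes Dom_in: "f \<in> Arr C \<Longrightarrow> Dom C f \<in> Obj C"
    and Cod_in: "f \<in> Arr C \<Longrightarrow> Cod C f \<in> Obj C"
    and Id_in: "c \<in> Obj C \<Longrightarrow> Id C c \<in> Hom C c c"
    and Comp_in: "f \<in> Hom C b c \<Longrightarrow> g \<in> Hom C c d \<Longrightarrow> Comp C g f \<in> Hom C b d"
    and Comp_Id: "f \<in> Hom C c d \<Longrightarrow> Comp C f (Id C c) = f"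
    and Id_Comp: "f \<in> Hom C c d \<Longrightarrow> Comp C (Id C d) f = f"
    and Comp_assoc: "f \<in> Hom C a b \<Longrightarrow> g \<in> Hom C b c \<Longrightarrow> h \<in> Hom C c d \<Longrightarrow>
      Comp C h (Comp C g f) = Comp C (Comp C h g) f"

record ('o, 'a, 'p, 'b) func =
  ObjMap :: "'o \<Rightarrow> 'p"
  ArrMap :: "'a \<Rightarrow> 'b"

locale cat_functor = dom: category C + cod: category D
  for F :: "('o, 'a, 'p, 'b) func" and C :: "('o, 'a) cat" and D :: "('p, 'b) cat" +
  assumes ObjMap_in: "c \<in> Obj C \<Longrightarrow> ObjMap F c \<in> Obj D"
    and ArrMap_in: "f \<in> Hom C c d \<Longrightarrow> ArrMap F f \<in> Hom D (ObjMap F c) (ObjMap F d)"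
    and ArrMap_Id: "c \<in> Obj C \<Longrightarrow> ArrMap F (Id C c) = Id D (ObjMap F c)"
    and ArrMap_Comp: "f \<in> Hom C b c \<Longrightarrow> g \<in> Hom C c d \<Longrightarrow>
      ArrMap F (Comp C g f) = Comp D (ArrMap F g) (ArrMap F f)"

definition func_comp ::
  "('p, 'b, 'q, 'c) func \<Rightarrow> ('o, 'a, 'p, 'b) func \<Rightarrow> ('o, 'a, 'q, 'c) func" where
  "func_comp G F = \<lparr>ObjMap = ObjMap G \<circ> ObjMap F, ArrMap = ArrMap G \<circ> ArrMap F\<rparr>"

text \<open>Equality of functors with source \<open>C\<close>: only the values on \<open>C\<close> matter.\<close>

definition func_eq ::
  "('o, 'a) cat \<Rightarrow> ('o, 'a, 'p, 'b) func \<Rightarrow> ('o, 'a, 'p, 'b) func \<Rightarrow> bool" where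
  "func_eq C F G \<longleftrightarrow>
    (\<forall>c\<in>Obj C. ObjMap F c = ObjMap G c) \<and> (\<forall>f\<in>Arr C. ArrMap F f = ArrMap G f)"

definition nat_trans ::
  "('o \<Rightarrow> 'b) \<Rightarrow> ('o, 'a, 'p, 'b) func \<Rightarrow> ('o, 'a, 'p, 'b) func \<Rightarrow>
    ('o, 'a) cat \<Rightarrow> ('p, 'b) cat \<Rightarrow> bool" where
  "nat_trans \<eta> F G C D \<longleftrightarrow>
    cat_functor F C D \<and> cat_functor G C D \<and>
    (\<forall>c\<in>Obj C. \<eta> c \<in> Hom D (ObjMap F c) (ObjMap G c)) \<and>
    (\<forall>c d. \<forall>f\<in>Hom C c d. Comp D (\<eta> d) (ArrMap F f) = Comp D (ArrMap G f) (\<eta> c))"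

definition subcategory :: "('o, 'a) cat \<Rightarrow> ('o, 'a) cat \<Rightarrow> bool" where
  "subcategory U B \<longleftrightarrow>
    category U \<and> category B \<and> Obj U \<subseteq> Obj B \<and> Arr U \<subseteq> Arr B \<and>
    (\<forall>f\<in>Arr U. Dom U f = Dom B f \<and> Cod U f = Cod B f) \<and>
    (\<forall>c\<in>Obj U. Id U c = Id B c) \<and>
    (\<forall>b c d. \<forall>f\<in>Hom U b c. \<forall>g\<in>Hom U c d. Comp U g f = Comp B g f)"

definition incl :: "('o, 'a, 'o, 'a) func" where
  "incl = \<lparr>ObjMap = (\<lambda>c. c), ArrMap = (\<lambda>f. f)\<rparr>"

section \<open>Sectional category of a functor\<close>

definition is_cover :: "('o, 'a) cat \<Rightarrow> nat \<Rightarrow> (nat \<Rightarrow> ('o, 'a) cat) \<Rightarrow> bool" where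
  "is_cover B n U \<longleftrightarrow>
    (\<forall>i\<le>n. subcategory (U i) B) \<and> (\<forall>f\<in>Arr B. \<exists>i\<le>n. f \<in> Arr (U i))"

definition secat_cover ::
  "('e, 'f) cat \<Rightarrow> ('o, 'a) cat \<Rightarrow> ('e, 'f, 'o, 'a) func \<Rightarrow> nat \<Rightarrow> bool" where
  "secat_cover E B P n \<longleftrightarrow>
    (\<exists>U s. is_cover B n U \<and>
      (\<forall>i\<le>n. cat_functor (s i) (U i) E \<and> func_eq (U i) (func_comp P (s i)) incl))"

definition dsecat_cover ::
  "('e, 'f) cat \<Rightarrow> ('o, 'a) cat \<Rightarrow> ('e, 'f, 'o, 'a) func \<Rightarrow> nat \<Rightarrow> bool" where
  "dsecat_cover E B P n \<longleftrightarrow>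
    (\<exists>U s. is_cover B n U \<and>
      (\<forall>i\<le>n. cat_functor (s i) (U i) E \<and>
        (\<exists>\<eta>. nat_trans \<eta> (func_comp P (s i)) incl (U i) B)))"

definition secat :: "('e, 'f) cat \<Rightarrow> ('o, 'a) cat \<Rightarrow> ('e, 'f, 'o, 'a) func \<Rightarrow> enat" where
  "secat E B P =
    (if \<exists>n. secat_cover E B P n then enat (LEAST n. secat_cover E B P n) else \<infinity>)"

definition dsecat :: "('e, 'f) cat \<Rightarrow> ('o, 'a) cat \<Rightarrow> ('e, 'f, 'o, 'a) func \<Rightarrow> enat" where
  "dsecat E B P =
    (if \<exists>n. dsecat_cover E B P n then enat (LEAST n. dsecat_cover E B P n) else \<infinity>)"

section \<open>Set-valued functors and categories of elements\<close>

text \<open>The category of sets and maps whose elements are drawn from a type \<open>'x\<close>. A map from \<open>A\<close>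
  to \<open>B\<close> is the triple \<open>(A, \<phi>, B)\<close> with \<open>\<phi>\<close> in \<open>A \<rightarrow>\<^sub>E B\<close>, so that equal maps are equal triples.
  A functor from a small category to \<open>Set\<close> is a functor to \<open>set_cat\<close> for some type \<open>'x\<close>.\<close>

type_synonym 'x set_map = "'x set \<times> ('x \<Rightarrow> 'x) \<times> 'x set"

definition set_cat :: "('x set, 'x set_map) cat" where
  "set_cat = \<lparr>
    Obj = UNIV,
    Arr = {(A, \<phi>, B). \<phi> \<in> A \<rightarrow>\<^sub>E B},
    Dom = (\<lambda>(A, \<phi>, B). A),
    Cod = (\<lambda>(A, \<phi>, B). B),
    Id = (\<lambda>A. (A, (\<lambda>x\<in>A. x), A)),
    Comp = (\<lambda>(B, \<psi>, D) (A, \<phi>, B'). (A, compose A \<psi> \<phi>, D))\<rparr>"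

type_synonym ('o, 'a, 'x) set_func = "('o, 'a, 'x set, 'x set_map) func"

text \<open>\<open>act X f x\<close> is \<open>X(f)(x)\<close>.\<close>

definition act :: "('o, 'a, 'x) set_func \<Rightarrow> 'a \<Rightarrow> 'x \<Rightarrow> 'x" where
  "act X f = fst (snd (ArrMap X f))"

text \<open>A morphism \<open>(c, x) \<rightarrow> (d, y)\<close> of the category of elements is recorded together with its
  source and target, since one \<open>f\<close> underlies many morphisms.\<close>

type_synonym ('o, 'a, 'x) elt_arr = "('o \<times> 'x) \<times> 'a \<times> ('o \<times> 'x)"

definition elements ::
  "('o, 'a) cat \<Rightarrow> ('o, 'a, 'x) set_func \<Rightarrow> ('o \<times> 'x, ('o, 'a, 'x) elt_arr) cat" where
  "elements C X = \<lparr>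
    Obj = {(c, x). c \<in> Obj C \<and> x \<in> ObjMap X c},
    Arr = {((c, x), f, (d, y)). c \<in> Obj C \<and> x \<in> ObjMap X c \<and> d \<in> Obj C \<and> y \<in> ObjMap X d \<and>
      f \<in> Hom C c d \<and> act X f x = y},
    Dom = (\<lambda>(p, f, q). p),
    Cod = (\<lambda>(p, f, q). q),
    Id = (\<lambda>(c, x). ((c, x), Id C c, (c, x))),
    Comp = (\<lambda>(q, g, r) (p, f, q'). (p, Comp C g f, r))\<rparr>"

definition elements_proj :: "('o \<times> 'x, ('o, 'a, 'x) elt_arr, 'o, 'a) func" where
  "elements_proj = \<lparr>ObjMap = (\<lambda>(c, x). c), ArrMap = (\<lambda>(p, f, q). f)\<rparr>"

text \<open>The morphism over \<open>f\<close> with source \<open>(Dom C f, x)\<close>; see \<open>elements_lift_unique\<close>.\<close>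

definition elements_lift ::
  "('o, 'a) cat \<Rightarrow> ('o, 'a, 'x) set_func \<Rightarrow> 'a \<Rightarrow> 'x \<Rightarrow> ('o, 'a, 'x) elt_arr" where
  "elements_lift C X f x = ((Dom C f, x), f, (Cod C f, act X f x))"

definition flatten_obj ::
  "('o, 'a, 'x) set_func \<Rightarrow> ('o \<times> 'x, ('o, 'a, 'x) elt_arr, 'y) set_func \<Rightarrow> 'o \<Rightarrow> ('x \<times> 'y) set"
  where "flatten_obj X Y c = Sigma (ObjMap X c) (\<lambda>x. ObjMap Y (c, x))"

definition flatten ::
  "('o, 'a) cat \<Rightarrow> ('o, 'a, 'x) set_func \<Rightarrow> ('o \<times> 'x, ('o, 'a, 'x) elt_arr, 'y) set_func \<Rightarrow>
    ('o, 'a, 'x \<times> 'y) set_func" where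
  "flatten C X Y = \<lparr>
    ObjMap = flatten_obj X Y,
    ArrMap = (\<lambda>f. (flatten_obj X Y (Dom C f),
      (\<lambda>(x, y)\<in>flatten_obj X Y (Dom C f). (act X f x, act Y (elements_lift C X f x) y)),
      flatten_obj X Y (Cod C f)))\<rparr>"

section \<open>The constructions are well defined\<close>

lemma category_set_cat: "category (set_cat :: ('x set, 'x set_map) cat)"
  by unfold_locales
    (auto simp: set_cat_def Hom_def compose_def PiE_iff extensional_def fun_eq_iff, metis)

lemma act_in:
  assumes "cat_functor X C set_cat" "f \<in> Hom C c d" "x \<in> ObjMap X c"
  shows "act X f x \<in> ObjMap X d"
  using cat_functor.ArrMap_in[OF assms(1,2)] assms(3)
  by (auto simp: set_cat_def Hom_def act_def split: prod.splits)

lemma act_Id: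
  assumes "cat_functor X C set_cat" "c \<in> Obj C" "x \<in> ObjMap X c"
  shows "act X (Id C c) x = x"
  using cat_functor.ArrMap_Id[OF assms(1,2)] assms(3) by (simp add: set_cat_def act_def)

lemma act_Comp:
  assumes "cat_functor X C set_cat" "f \<in> Hom C b c" "g \<in> Hom C c d" "x \<in> ObjMap X b"
  shows "act X (Comp C g f) x = act X g (act X f x)"
  using cat_functor.ArrMap_Comp[OF assms(1-3)] cat_functor.ArrMap_in[OF assms(1,2)]
    cat_functor.ArrMap_in[OF assms(1,3)] assms(4)
  by (auto simp: set_cat_def Hom_def act_def compose_def split: prod.splits)

lemma Hom_elements:
  "Hom (elements C X) (c, x) (d, y) =
    {((c, x), f, (d, y)) | f. c \<in> Obj C \<and> x \<in> ObjMap X c \<and> d \<in> Obj C \<and> y \<in> ObjMap X d \<and>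
      f \<in> Hom C c d \<and> act X f x = y}"
  by (auto simp: Hom_def elements_def)

lemma category_elements:
  assumes X: "cat_functor X C set_cat"
  shows "category (elements C X)"
proof -
  interpret category C using X by (rule cat_functor.axioms(1))
  have c: "Comp (elements C X) (q, g, r) (p, f, q') = (p, Comp C g f, r)" for p q r q' f g
    by (simp add: elements_def)
  have i: "Id (elements C X) (c, x) = ((c, x), Id C c, (c, x))" for c x
    by (simp add: elements_def)
  show ?thesis
  proof
    fix f assume "f \<in> Arr (elements C X)"
    then show "Dom (elements C X) f \<in> Obj (elements C X)"
      and "Cod (elements C X) f \<in> Obj (elements C X)"
      by (auto simp: elements_def)
  next
    fix p assume "p \<in> Obj (elements C X)"
    then show "Id (elements C X) p \<in> Hom (elements C X) p p"
      by (cases p) (auto simp: i Hom_elements Id_in act_Id[OF X], auto simp: elements_def Id_in act_Id[OF X])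
  next
    fix f g p q r
    assume "f \<in> Hom (elements C X) p q" "g \<in> Hom (elements C X) q r"
    then show "Comp (elements C X) g f \<in> Hom (elements C X) p r"
      by (cases p; cases q; cases r) (auto simp: c Hom_elements act_Comp[OF X] intro: Comp_in)
  next
    fix f p q assume "f \<in> Hom (elements C X) p q"
    then show "Comp (elements C X) f (Id (elements C X) p) = f"
      and "Comp (elements C X) (Id (elements C X) q) f = f"
      by (cases p; cases q; auto simp: c i Hom_elements Comp_Id Id_Comp)+
  next
    fix f g h p q r t
    assume "f \<in> Hom (elements C X) p q" "g \<in> Hom (elements C X) q r" "h \<in> Hom (elements C X) r t"
    then show "Comp (elements C X) h (Comp (elements C X) g f) =
        Comp (elements C X) (Comp (elements C X) h g) f"
      by (cases p; cases q; cases r; cases t) (auto simp: c Hom_elements Comp_assoc)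
  qed
qed

lemma cat_functor_elements_proj:
  assumes X: "cat_functor X C set_cat"
  shows "cat_functor elements_proj (elements C X) C"
proof -
  interpret dom: category "elements C X" using X by (rule category_elements)
  interpret cod: category C using X by (rule cat_functor.axioms(1))
  show ?thesis
    by unfold_locales (auto simp: elements_def elements_proj_def Hom_def)
qed

lemma elements_lift_unique:
  assumes X: "cat_functor X C set_cat" and f: "f \<in> Hom C c d" and x: "x \<in> ObjMap X c"
  shows "\<exists>!m. m \<in> Arr (elements C X) \<and> Dom (elements C X) m = (c, x) \<and>
      ArrMap elements_proj m = f"
    and "elements_lift C X f x \<in> Hom (elements C X) (c, x) (d, act X f x)"
    and "ArrMap elements_proj (elements_lift C X f x) = f"
proof -
  interpret category C using X by (rule cat_functor.axioms(1))
  have cd: "c \<in> Obj C" "d \<in> Obj C" using f Dom_in Cod_in by (auto simp: Hom_def)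
  show l: "elements_lift C X f x \<in> Hom (elements C X) (c, x) (d, act X f x)"
    using f x cd act_in[OF X f x] by (auto simp: Hom_elements) (auto simp: elements_lift_def Hom_def)
  show p: "ArrMap elements_proj (elements_lift C X f x) = f"
    by (simp add: elements_lift_def elements_proj_def)
  show "\<exists>!m. m \<in> Arr (elements C X) \<and> Dom (elements C X) m = (c, x) \<and>
      ArrMap elements_proj m = f"
    by (rule ex1I[of _ "elements_lift C X f x"])
      (use l p f in \<open>auto simp: Hom_def elements_lift_def elements_def elements_proj_def\<close>)
qed

lemma cat_functor_flatten:
  assumes X: "cat_functor X C set_cat" and Y: "cat_functor Y (elements C X) set_cat"
  shows "cat_functor (flatten C X Y) C set_cat"
proof -
  interpret dom: category C using X by (rule cat_functor.axioms(1))
  interpret cod: category set_cat by (rule category_set_cat)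
  interpret el: category "elements C X" using X by (rule category_elements)
  note L = elements_lift_unique(2)[OF X]
  show ?thesis
  proof unfold_locales
    fix c assume "c \<in> Obj C"
    show "ObjMap (flatten C X Y) c \<in> Obj set_cat" by (simp add: set_cat_def)
  next
    fix f c d assume f: "f \<in> Hom C c d"
    then have "Dom C f = c" "Cod C f = d" by (auto simp: Hom_def)
    then show "ArrMap (flatten C X Y) f
        \<in> Hom set_cat (ObjMap (flatten C X Y) c) (ObjMap (flatten C X Y) d)"
      using act_in[OF X f] act_in[OF Y L[OF f]]
      by (auto simp: flatten_def flatten_obj_def set_cat_def Hom_def)
  next
    fix c assume c: "c \<in> Obj C"
    have d: "Dom C (Id C c) = c" "Cod C (Id C c) = c" using dom.Id_in[OF c] by (auto simp: Hom_def)
    have "act Y (elements_lift C X (Id C c) x) y = y"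
      if "x \<in> ObjMap X c" "y \<in> ObjMap Y (c, x)" for x y
    proof -
      have "elements_lift C X (Id C c) x = Id (elements C X) (c, x)"
        using that d by (simp add: elements_lift_def elements_def act_Id[OF X c])
      moreover have "(c, x) \<in> Obj (elements C X)" using c that by (simp add: elements_def)
      ultimately show ?thesis using act_Id[OF Y] that by simp
    qed
    then show "ArrMap (flatten C X Y) (Id C c) = Id set_cat (ObjMap (flatten C X Y) c)"
      by (auto simp: flatten_def flatten_obj_def set_cat_def d act_Id[OF X c] fun_eq_iff restrict_def)
  next
    fix f g b c d assume f: "f \<in> Hom C b c" and g: "g \<in> Hom C c d"
    have d: "Dom C f = b" "Cod C f = c" "Dom C g = c" "Cod C g = d"
      "Dom C (Comp C g f) = b" "Cod C (Comp C g f) = d"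
      using f g dom.Comp_in[OF f g] by (auto simp: Hom_def)
    have "act Y (elements_lift C X (Comp C g f) x) y =
        act Y (elements_lift C X g (act X f x)) (act Y (elements_lift C X f x) y)"
      if x: "x \<in> ObjMap X b" and y: "y \<in> ObjMap Y (b, x)" for x y
    proof -
      have "elements_lift C X (Comp C g f) x =
          Comp (elements C X) (elements_lift C X g (act X f x)) (elements_lift C X f x)"
        using d by (simp add: elements_lift_def elements_def act_Comp[OF X f g x])
      then show ?thesis
        using act_Comp[OF Y L[OF f x] L[OF g act_in[OF X f x]] y] by simp
    qed
    then show "ArrMap (flatten C X Y) (Comp C g f) =
        Comp set_cat (ArrMap (flatten C X Y) g) (ArrMap (flatten C X Y) f)"
      using act_in[OF X f] act_in[OF Y L[OF f]]
      by (auto simp: flatten_def flatten_obj_def set_cat_def d act_Comp[OF X f g] fun_eq_iff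
          restrict_def compose_def)
  qed
qed

end

theory Submission
  imports Defs
begin

text \<open>Forgetting the second component, \<open>(c, (x, y)) \<mapsto> (c, x)\<close>, is a functor from the category
  of elements of \<open>\<Sigma>\<^sub>X Y\<close> to that of \<open>X\<close> over \<open>C\<close>, so local (homotopy) sections of the former
  projection push forward to local (homotopy) sections of the latter.\<close>

lemma cat_functor_func_comp:
  assumes F: "cat_functor F A B" and G: "cat_functor G B D"
  shows "cat_functor (func_comp G F) A D"
proof -
  interpret F: cat_functor F A B by (rule F)
  interpret G: cat_functor G B D by (rule G)
  show ?thesis
  proof unfold_locales
    fix f g b c d assume "f \<in> Hom A b c" "g \<in> Hom A c d"
    then show "ArrMap (func_comp G F) (Comp A g f) =
        Comp D (ArrMap (func_comp G F) g) (ArrMap (func_comp G F) f)"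
      using F.ArrMap_in[of f b c] F.ArrMap_in[of g c d]
      by (simp add: func_comp_def F.ArrMap_Comp G.ArrMap_Comp)
  qed (auto simp: func_comp_def F.ObjMap_in G.ObjMap_in F.ArrMap_Id G.ArrMap_Id
      intro: F.ArrMap_in G.ArrMap_in)
qed

lemma func_comp_assoc: "func_comp H (func_comp G F) = func_comp (func_comp H G) F"
  by (simp add: func_comp_def comp_assoc)

text \<open>The cover is kept and each local section \<open>s i\<close> is replaced by its composite
  with \<open>G\<close>; applying \<open>P\<close> to that composite gives back
  \<open>func_comp P' (s i)\<close>.\<close>

lemma secat_cover_over:
  assumes G: "cat_functor G E' E" and P: "func_comp P G = P'"
    and cover: "secat_cover E' B P' n"
  shows "secat_cover E B P n"
proof -
  obtain U s where "is_cover B n U" and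
    "\<forall>i\<le>n. cat_functor (s i) (U i) E' \<and> func_eq (U i) (func_comp P' (s i)) incl"
    using cover by (auto simp: secat_cover_def)
  then show ?thesis
    unfolding secat_cover_def
    by (intro exI[of _ U] exI[of _ "\<lambda>i. func_comp G (s i)"])
      (simp add: func_comp_assoc P cat_functor_func_comp[OF _ G])
qed

text \<open>After reassociation \<open>P\<close> applied to the new local functor is literally
  \<open>func_comp P' (s i)\<close>, so the given \<eta> serves unchanged.\<close>

lemma dsecat_cover_over:
  assumes G: "cat_functor G E' E" and P: "func_comp P G = P'"
    and cover: "dsecat_cover E' B P' n"
  shows "dsecat_cover E B P n"
proof -
  obtain U s where "is_cover B n U" and
    "\<forall>i\<le>n. cat_functor (s i) (U i) E' \<and>
      (\<exists>\<eta>. nat_trans \<eta> (func_comp P' (s i)) incl (U i) B)"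
    using cover by (auto simp: dsecat_cover_def)
  then show ?thesis
    unfolding dsecat_cover_def
    by (intro exI[of _ U] exI[of _ "\<lambda>i. func_comp G (s i)"])
      (simp add: func_comp_assoc P cat_functor_func_comp[OF _ G])
qed

text \<open>The least length that works for \<open>P'\<close> also works for \<open>P\<close> and so
  bounds the minimum for \<open>P\<close>; if none works for \<open>P'\<close>, the right-hand side
  is infinite.\<close>

lemma secat_le_over:
  assumes "cat_functor G E' E" and "func_comp P G = P'"
  shows "secat E B P \<le> secat E' B P'"
proof (cases "\<exists>n. secat_cover E' B P' n")
  case True
  then have "secat_cover E B P (LEAST n. secat_cover E' B P' n)"
    by (rule secat_cover_over[OF assms LeastI_ex])
  with True show ?thesis by (auto simp: secat_def intro: Least_le)
qed (simp add: secat_def)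

lemma dsecat_le_over:
  assumes "cat_functor G E' E" and "func_comp P G = P'"
  shows "dsecat E B P \<le> dsecat E' B P'"
proof (cases "\<exists>n. dsecat_cover E' B P' n")
  case True
  then have "dsecat_cover E B P (LEAST n. dsecat_cover E' B P' n)"
    by (rule dsecat_cover_over[OF assms LeastI_ex])
  with True show ?thesis by (auto simp: dsecat_def intro: Least_le)
qed (simp add: dsecat_def)

definition forget_obj :: "'o \<times> ('x \<times> 'y) \<Rightarrow> 'o \<times> 'x" where
  "forget_obj = (\<lambda>(c, (x, y)). (c, x))"

definition flatten_forget ::
  "('o \<times> ('x \<times> 'y), ('o, 'a, 'x \<times> 'y) elt_arr, 'o \<times> 'x, ('o, 'a, 'x) elt_arr) func" where
  "flatten_forget = \<lparr>ObjMap = forget_obj,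
    ArrMap = (\<lambda>(p, f, q). (forget_obj p, f, forget_obj q))\<rparr>"

text \<open>This is an equality of records, valid at all arguments and not only on the category, so
  it can serve as the rewriting hypothesis \<open>func_comp P G = P'\<close>.\<close>

lemma elements_proj_flatten_forget: "func_comp elements_proj flatten_forget = elements_proj"
  by (auto simp: func_comp_def elements_proj_def flatten_forget_def forget_obj_def fun_eq_iff)

text \<open>The first coordinate of the action of \<open>flatten C X Y\<close> on (x, y) is
  \<open>act X f x\<close>, so dropping y preserves the condition that defines morphisms of
  elements.\<close>

lemma cat_functor_flatten_forget:
  assumes X: "cat_functor X C set_cat" and Y: "cat_functor Y (elements C X) set_cat"
  shows "cat_functor flatten_forget (elements C (flatten C X Y)) (elements C X)"
proof -
  interpret dom: category "elements C (flatten C X Y)"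
    by (rule category_elements[OF cat_functor_flatten[OF X Y]])
  interpret cod: category "elements C X" by (rule category_elements[OF X])
  show ?thesis
    by unfold_locales
      (auto simp: elements_def flatten_forget_def forget_obj_def Hom_def flatten_def
        flatten_obj_def act_def)
qed

theorem corollary7p6:
  fixes C :: "('o, 'a) cat"
    and X :: "('o, 'a, 'x) set_func"
    and Y :: "('o \<times> 'x, ('o, 'a, 'x) elt_arr, 'y) set_func"
  assumes "category C"
    and "cat_functor X C set_cat"
    and "cat_functor Y (elements C X) set_cat"
  shows "dsecat (elements C X) C elements_proj
      \<le> dsecat (elements C (flatten C X Y)) C elements_proj
    \<and> secat (elements C X) C elements_proj
      \<le> secat (elements C (flatten C X Y)) C elements_proj"
  using cat_functor_flatten_forget[OF assms(2,3)] elements_proj_flatten_forget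
  by (blast intro: dsecat_le_over secat_le_over)

end
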